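(* Let $\mathscr{P}$ be countable compactness and let $X$ be a normal space. Then $$\lambda_{\mathscr{P}}X=\mathrm{int}_{\beta X}\upsilon X.$$
   Context: Spaces are topological spaces, assumed non-empty. Normal and completely regular spaces are Hausdorff. $C_b(X)$ is the set of continuous bounded scalar-valued functions on $X$ (scalars $\mathbb{R}$ or $\mathbb{C}$, fixed); $\mathrm{Coz}(f)=\{x\in X:f(x)\neq0\}$ and $\mathrm{Coz}(X)=\{\mathrm{Coz}(f):f\in C_b(X)\}$. $\beta X$ is the Stone–Čech compactification of $X$. For a topological property $\mathscr{P}$ and completely regular $X$, $$\lambda_{\mathscr{P}}X=\bigcup\{\mathrm{int}_{\beta X}\mathrm{cl}_{\beta X}C: C\in\mathrm{Coz}(X)\text{ and }\mathrm{cl}_XC\text{ has }\mathscr{P}\}\subseteq\beta X.$$ A space is realcompact if it is homeomorphic to a closed subspace of some product $\mathbb{R}^\alpha$. The Hewitt realcompactification $\upsilon X$ of a completely regular space $X$ is the realcompact space containing $X$ as a dense subspace and such that every continuous $f:X\to\mathbb{R}$ extends continuously over $\upsilon X$; it is regarded in the standard way as a subspace of $\beta X$ with $X\subseteq\upsilon X\subseteq\beta X$. *)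

theory Defs
  imports "HOL-Analysis.Analysis"
begin

definition countably_compact_space :: "'a topology \<Rightarrow> bool" where
  "countably_compact_space X \<longleftrightarrow>
    (\<forall>\<U>. countable \<U> \<and> (\<forall>U\<in>\<U>. openin X U) \<and> topspace X \<subseteq> \<Union>\<U>
      \<longrightarrow> (\<exists>\<F>. finite \<F> \<and> \<F> \<subseteq> \<U> \<and> topspace X \<subseteq> \<Union>\<F>))"

text \<open>
  The exponent of the power of the real line ought to be an arbitrary set, of any type.
  Exponents that are sets of functions on the underlying type suffice: by
  \<open>realcompact_spaceI\<close> below, a space that is homeomorphic to a closed subspace of a power
  with exponent of any other type satisfies the definition too.
\<close>

definition realcompact_space :: "'a topology \<Rightarrow> bool" where
  "realcompact_space X \<longleftrightarrow>
    (\<exists>(I :: ('a \<Rightarrow> real) set) C. closedin (powertop_real I) C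
        \<and> X homeomorphic_space subtopology (powertop_real I) C)"

lemma realcompact_spaceI:
  fixes X :: "'a topology" and I :: "'i set"
  assumes C: "closedin (powertop_real I) C"
    and X: "X homeomorphic_space subtopology (powertop_real I) C"
  shows "realcompact_space X"
proof -
  obtain h k where "homeomorphic_maps X (subtopology (powertop_real I) C) h k"
    using X unfolding homeomorphic_space_def by blast
  then have h: "continuous_map X (subtopology (powertop_real I) C) h"
    and k: "continuous_map (subtopology (powertop_real I) C) X k"
    and kh: "\<And>x. x \<in> topspace X \<Longrightarrow> k (h x) = x"
    and hk: "\<And>y. y \<in> topspace (subtopology (powertop_real I) C) \<Longrightarrow> h (k y) = y"
    unfolding homeomorphic_maps_def by auto
  have CI: "C \<subseteq> topspace (powertop_real I)"
    using C closedin_subset by blast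
  have h': "continuous_map X (powertop_real I) h" and hC: "h \<in> topspace X \<rightarrow> C"
    using h by (auto simp: continuous_map_in_subtopology)
  define c where "c = (\<lambda>i x. h x i)"
  define J where "J = c ` I"
  define r where "r = (\<lambda>y. \<lambda>i\<in>I. y (c i) :: real)"
  define e where "e = (\<lambda>x. \<lambda>\<phi>\<in>J. \<phi> x :: real)"
  define D where "D = {y \<in> topspace (powertop_real J). r y \<in> C}"
  have r: "continuous_map (powertop_real J) (powertop_real I) r"
    unfolding continuous_map_componentwise
  proof (intro conjI ballI)
    show "r ` topspace (powertop_real J) \<subseteq> extensional I"
      by (auto simp: r_def)
    fix i assume "i \<in> I"
    then have "c i \<in> J" by (simp add: J_def)
    then show "continuous_map (powertop_real J) euclideanreal (\<lambda>y. r y i)"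
      using \<open>i \<in> I\<close> continuous_map_product_projection[of "c i" J "\<lambda>_. euclideanreal"]
      by (simp add: r_def)
  qed
  have D: "closedin (powertop_real J) D"
    unfolding D_def using r C by (rule closedin_continuous_map_preimage)
  have e: "continuous_map X (powertop_real J) e"
    unfolding continuous_map_componentwise
  proof (intro conjI ballI)
    show "e ` topspace X \<subseteq> extensional J"
      by (auto simp: e_def)
    fix \<phi> assume "\<phi> \<in> J"
    then obtain i where i: "i \<in> I" "\<phi> = c i" by (auto simp: J_def)
    have "continuous_map X euclideanreal (\<lambda>x. h x i)"
      using h' i(1) by (simp add: continuous_map_componentwise)
    then show "continuous_map X euclideanreal (\<lambda>x. e x \<phi>)"
      using \<open>\<phi> \<in> J\<close> i by (simp add: e_def c_def)
  qed
  have re: "r (e x) = h x" if "x \<in> topspace X" for x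
  proof -
    have "h x \<in> extensional I"
      using hC CI that by (auto simp: PiE_def)
    then show ?thesis
      by (auto simp: r_def e_def J_def c_def extensional_def fun_eq_iff)
  qed
  have eD: "e \<in> topspace X \<rightarrow> D"
    using e re hC by (auto simp: D_def continuous_map_def Pi_iff)
  have rD: "continuous_map (subtopology (powertop_real J) D) (subtopology (powertop_real I) C) r"
    using r by (auto simp: continuous_map_in_subtopology continuous_map_from_subtopology D_def)
  have ek: "e (k (r y)) = y" if "y \<in> D" for y
  proof -
    have yC: "r y \<in> topspace (subtopology (powertop_real I) C)"
      using that CI by (auto simp: D_def)
    have "y \<in> extensional J"
      using that by (auto simp: D_def PiE_def)
    moreover have "e (k (r y)) (c i) = y (c i)" if "i \<in> I" for i
      using hk[OF yC] that by (simp add: e_def J_def c_def) (simp add: r_def c_def)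
    moreover have "e (k (r y)) \<in> extensional J"
      by (simp add: e_def)
    ultimately show ?thesis
      by (intro extensionalityI[of _ J]) (auto simp: J_def)
  qed
  have "homeomorphic_maps X (subtopology (powertop_real J) D) e (k \<circ> r)"
    unfolding homeomorphic_maps_def
    using e eD continuous_map_compose[OF rD k] ek re kh
    by (auto simp: continuous_map_in_subtopology)
  then show ?thesis
    using D unfolding realcompact_space_def homeomorphic_space_def by blast
qed

definition cozero_set :: "'a topology \<Rightarrow> ('a \<Rightarrow> 'k::real_normed_field) \<Rightarrow> 'a set" where
  "cozero_set X f = {x \<in> topspace X. f x \<noteq> 0}"

text \<open>The type argument is the scalar field.\<close>

definition cozero_sets :: "'k::real_normed_field itself \<Rightarrow> 'a topology \<Rightarrow> 'a set set" where
  "cozero_sets K X =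
    {cozero_set X f | f :: 'a \<Rightarrow> 'k. continuous_map X euclidean f \<and> bounded (f ` topspace X)}"

text \<open>
  The Stone-Cech compactification is the closure of the image of \<open>X\<close> under the evaluation map
  into the cube whose coordinates are the continuous functions from \<open>X\<close> to the unit interval;
  for completely regular Hausdorff \<open>X\<close> that map is an embedding and \<open>X\<close> is identified with its
  image. Requiring extensionality makes functions on \<open>topspace X\<close> correspond to a
  single coordinate each.
\<close>

definition unit_maps :: "'a topology \<Rightarrow> ('a \<Rightarrow> real) set" where
  "unit_maps X = {f \<in> extensional (topspace X). continuous_map X (top_of_set {0..1}) f}"

definition unit_cube :: "'a topology \<Rightarrow> (('a \<Rightarrow> real) \<Rightarrow> real) topology" where
  "unit_cube X = product_topology (\<lambda>_. top_of_set {0..1}) (unit_maps X)"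

definition stone_cech_map :: "'a topology \<Rightarrow> 'a \<Rightarrow> ('a \<Rightarrow> real) \<Rightarrow> real" where
  "stone_cech_map X x = (\<lambda>f\<in>unit_maps X. f x)"

definition stone_cech :: "'a topology \<Rightarrow> (('a \<Rightarrow> real) \<Rightarrow> real) topology" where
  "stone_cech X =
    subtopology (unit_cube X) (unit_cube X closure_of (stone_cech_map X ` topspace X))"

definition lambda_ext ::
    "'k::real_normed_field itself \<Rightarrow> ('a topology \<Rightarrow> bool) \<Rightarrow> 'a topology
      \<Rightarrow> (('a \<Rightarrow> real) \<Rightarrow> real) set" where
  "lambda_ext K P X =
    \<Union> {stone_cech X interior_of (stone_cech X closure_of (stone_cech_map X ` C)) | C.
          C \<in> cozero_sets K X \<and> P (subtopology X (X closure_of C))}"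

definition is_hewitt_realcompactification ::
    "'a topology \<Rightarrow> (('a \<Rightarrow> real) \<Rightarrow> real) set \<Rightarrow> bool" where
  "is_hewitt_realcompactification X U \<longleftrightarrow>
    stone_cech_map X ` topspace X \<subseteq> U \<and> U \<subseteq> topspace (stone_cech X)
    \<and> realcompact_space (subtopology (stone_cech X) U)
    \<and> subtopology (stone_cech X) U closure_of (stone_cech_map X ` topspace X) = U
    \<and> (\<forall>f. continuous_map X euclideanreal f \<longrightarrow>
          (\<exists>g. continuous_map (subtopology (stone_cech X) U) euclideanreal g
             \<and> (\<forall>x\<in>topspace X. g (stone_cech_map X x) = f x)))"

text \<open>
  For completely regular Hausdorff \<open>X\<close> exactly one set satisfies this predicate.
\<close>

definition hewitt :: "'a topology \<Rightarrow> (('a \<Rightarrow> real) \<Rightarrow> real) set" where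
  "hewitt X = (THE U. is_hewitt_realcompactification X U)"

end

theory Submission
  imports Defs
begin

text \<open>
  The Hewitt realcompactification consists of the points of the Stone-Cech compactification at
  which the extension of every positive function on \<open>X\<close> remains positive.

  If the closure of a cozero set is countably compact, a positive function is bounded away from
  zero on it, so the closure of that set in the compactification lies in the Hewitt
  realcompactification. Conversely, a point in the interior of the Hewitt realcompactification
  has a neighbourhood \<open>{F < 1/2}\<close> such that the compact set \<open>{F \<le> 1/2}\<close> is still contained in the
  Hewitt realcompactification. Every real function on \<open>X\<close> is then bounded on the trace of
  \<open>{F \<le> 1/2}\<close>, and for a closed subset of a normal space this forces countable compactness: a
  countable cover without finite subcover yields a closed discrete set with an unbounded function
  on it, which extends to \<open>X\<close> by Tietze's theorem.
\<close>

section \<open>The Stone-Cech compactification\<close>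

lemma stone_cech_map_apply: "f \<in> unit_maps X \<Longrightarrow> stone_cech_map X x f = f x"
  by (simp add: stone_cech_map_def)

lemma continuous_map_stone_cech_map_unit_cube: "continuous_map X (unit_cube X) (stone_cech_map X)"
  unfolding unit_cube_def continuous_map_componentwise
proof (intro conjI ballI)
  show "stone_cech_map X ` topspace X \<subseteq> extensional (unit_maps X)"
    by (auto simp: stone_cech_map_def)
  fix f assume "f \<in> unit_maps X"
  then show "continuous_map X (top_of_set {0..1}) (\<lambda>x. stone_cech_map X x f)"
    by (simp add: stone_cech_map_apply) (simp add: unit_maps_def)
qed

lemma topspace_stone_cech:
  "topspace (stone_cech X) = unit_cube X closure_of (stone_cech_map X ` topspace X)"
  unfolding stone_cech_def using closure_of_subset_topspace by fastforce

lemma stone_cech_map_in_topspace: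
  assumes "x \<in> topspace X"
  shows "stone_cech_map X x \<in> topspace (stone_cech X)"
proof -
  have "stone_cech_map X ` topspace X \<subseteq> unit_cube X closure_of (stone_cech_map X ` topspace X)"
    by (intro closure_of_subset continuous_map_image_subset_topspace[OF continuous_map_stone_cech_map_unit_cube])
  then show ?thesis
    using assms unfolding topspace_stone_cech by auto
qed

lemma continuous_map_stone_cech_map: "continuous_map X (stone_cech X) (stone_cech_map X)"
proof -
  have "continuous_map X (subtopology (unit_cube X) (topspace (stone_cech X))) (stone_cech_map X)"
    using continuous_map_stone_cech_map_unit_cube stone_cech_map_in_topspace
    by (auto intro!: continuous_map_into_subtopology)
  then show ?thesis
    by (subst stone_cech_def) (simp flip: topspace_stone_cech)
qed

lemma stone_cech_dense:
  "stone_cech X closure_of (stone_cech_map X ` topspace X) = topspace (stone_cech X)"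
proof -
  have "stone_cech_map X ` topspace X \<subseteq> unit_cube X closure_of (stone_cech_map X ` topspace X)"
    by (metis image_subsetI stone_cech_map_in_topspace topspace_stone_cech)
  then show ?thesis
    unfolding topspace_stone_cech by (simp add: stone_cech_def closure_of_subtopology Int_absorb1)
qed

lemma compact_space_stone_cech: "compact_space (stone_cech X)"
proof -
  have "compact_space (unit_cube X)"
    unfolding unit_cube_def compact_space_product_topology
    by (simp add: compact_space_subtopology)
  then show ?thesis
    unfolding stone_cech_def
    by (simp add: closedin_compact_space compact_space_subtopology)
qed

lemma Hausdorff_space_stone_cech: "Hausdorff_space (stone_cech X)"
  unfolding stone_cech_def unit_cube_def
  by (simp add: Hausdorff_space_subtopology Hausdorff_space_product_topology)

lemma unit_cube_eq:
  "unit_cube X = subtopology (powertop_real (unit_maps X)) (unit_maps X \<rightarrow>\<^sub>E {0..1})"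
  unfolding unit_cube_def by (rule subtopology_product_topology[symmetric])

text \<open>Realcompactness speaks of powers of the whole line, so the cube is traded here for
  \<open>powertop_real\<close>.\<close>

lemma stone_cech_eq:
  "stone_cech X = subtopology (powertop_real (unit_maps X)) (topspace (stone_cech X))"
proof -
  have "topspace (stone_cech X) \<subseteq> (unit_maps X \<rightarrow>\<^sub>E {0..1})"
    unfolding stone_cech_def by (auto simp: unit_cube_eq)
  then show ?thesis
    by (metis Int_absorb1 stone_cech_def subtopology_subtopology topspace_stone_cech unit_cube_eq)
qed

lemma closedin_topspace_stone_cech:
  "closedin (powertop_real (unit_maps X)) (topspace (stone_cech X))"
proof -
  have "topspace (stone_cech X) \<subseteq> topspace (powertop_real (unit_maps X))"
    by (subst stone_cech_eq) auto
  then have "compactin (powertop_real (unit_maps X)) (topspace (stone_cech X))"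
    using compact_space_stone_cech[of X] stone_cech_eq[of X] by (metis compactin_subspace)
  then show ?thesis
    by (simp add: compactin_imp_closedin Hausdorff_space_product_topology)
qed

lemma continuous_map_stone_cech_eval:
  assumes "f \<in> unit_maps X"
  shows "continuous_map (stone_cech X) euclideanreal (\<lambda>p. p f)"
  using assms
  by (subst stone_cech_eq)
    (rule continuous_map_from_subtopology[OF
        continuous_map_product_projection[where X = "\<lambda>_. euclideanreal"]])

text \<open>Since \<open>1 + h x\<close> is at least 1, its reciprocal lies in (0,1]. A possibly
  unbounded \<open>h\<close> is thus encoded by a positive coordinate of the cube; the restriction
  supplies the extensionality demanded by \<open>unit_maps\<close>.\<close>

lemma restrict_inverse_in_unit_maps:
  assumes "continuous_map X euclideanreal h" and "\<And>x. x \<in> topspace X \<Longrightarrow> 0 \<le> h x"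
  shows "(\<lambda>x\<in>topspace X. inverse (1 + h x)) \<in> unit_maps X"
proof -
  have "continuous_map X euclideanreal (\<lambda>x. inverse (1 + h x))"
    using assms by (intro continuous_intros) (auto simp: add_nonneg_eq_0_iff)
  then have "continuous_map X euclideanreal (\<lambda>x\<in>topspace X. inverse (1 + h x))"
    by (rule continuous_map_eq) simp
  then show ?thesis
    using assms(2)
    by (auto simp: unit_maps_def continuous_map_in_subtopology inverse_le_1_iff)
qed

section \<open>The Hewitt realcompactification\<close>

text \<open>The coordinate \<open>p f\<close> is the value at \<open>p\<close> of the continuous
  extension of \<open>f\<close>. This is the classical description of \<upsilon>X: the points lying
  in no zero set of \<beta>X that misses X.\<close>

definition positive_points :: "'a topology \<Rightarrow> (('a \<Rightarrow> real) \<Rightarrow> real) set" where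
  "positive_points X = {p \<in> topspace (stone_cech X).
     \<forall>f\<in>unit_maps X. (\<forall>x\<in>topspace X. 0 < f x) \<longrightarrow> 0 < p f}"

lemma positive_points_subset: "positive_points X \<subseteq> topspace (stone_cech X)"
  by (auto simp: positive_points_def)

lemma stone_cech_map_in_positive_points:
  "x \<in> topspace X \<Longrightarrow> stone_cech_map X x \<in> positive_points X"
  by (simp add: positive_points_def stone_cech_map_in_topspace stone_cech_map_apply)

lemma topspace_positive_points [simp]:
  "topspace (subtopology (stone_cech X) (positive_points X)) = positive_points X"
  using positive_points_subset by auto

lemma closure_of_subspace_stone_cech:
  assumes "stone_cech_map X ` topspace X \<subseteq> U" and "U \<subseteq> topspace (stone_cech X)"
  shows "subtopology (stone_cech X) U closure_of (stone_cech_map X ` topspace X) = U"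
  using assms by (simp add: closure_of_subtopology Int_absorb1 stone_cech_dense Int_absorb2)

text \<open>Split \<open>f\<close> into positive and negative part and encode both by the positive
  coordinates \<open>u\<close> and \<open>v\<close>. Neither vanishes at a positive point, so both
  can be inverted there; the summands 1 cancel in the difference.\<close>

lemma positive_points_extension:
  assumes "continuous_map X euclideanreal f"
  shows "\<exists>g. continuous_map (subtopology (stone_cech X) (positive_points X)) euclideanreal g
    \<and> (\<forall>x\<in>topspace X. g (stone_cech_map X x) = f x)"
proof -
  define u where "u = (\<lambda>x\<in>topspace X. inverse (1 + max 0 (f x)))"
  define v where "v = (\<lambda>x\<in>topspace X. inverse (1 + max 0 (- f x)))"
  have u: "u \<in> unit_maps X" and v: "v \<in> unit_maps X"
    unfolding u_def v_def
    by (intro restrict_inverse_in_unit_maps continuous_intros assms; simp)+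
  have "0 < u x" "0 < v x" if "x \<in> topspace X" for x
    using that by (auto simp: u_def v_def add_pos_nonneg)
  then have pos: "0 < p u" "0 < p v" if "p \<in> positive_points X" for p
    using that u v by (auto simp: positive_points_def)
  have "continuous_map (subtopology (stone_cech X) (positive_points X)) euclideanreal
          (\<lambda>p. inverse (p u) - inverse (p v))"
    using pos by (intro continuous_intros continuous_map_from_subtopology
        continuous_map_stone_cech_eval u v) force+
  moreover have "inverse (stone_cech_map X x u) - inverse (stone_cech_map X x v) = f x"
    if "x \<in> topspace X" for x
    using that by (simp add: stone_cech_map_apply u v) (simp add: u_def v_def)
  ultimately show ?thesis by blast
qed

text \<open>
  The coordinates \<open>p f\<close> together with the reciprocals of those belonging to positive \<open>f\<close> embed
  the positive points as a closed set, cut out by the equations \<open>p f * (1 / p f) = 1\<close>.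
\<close>

lemma realcompact_space_positive_points:
  "realcompact_space (subtopology (stone_cech X) (positive_points X))"
proof -
  define M where "M = unit_maps X"
  define N where "N = {f \<in> M. \<forall>x\<in>topspace X. 0 < f x}"
  \<comment> \<open>A disjoint sum, because a positive \<open>f\<close> owns two coordinates: its
    value at \<open>Inl f\<close> and the reciprocal at \<open>Inr f\<close>.\<close>
  define I :: "(('a \<Rightarrow> real) + ('a \<Rightarrow> real)) set" where "I = M <+> N"
  define \<pi> where "\<pi> = (\<lambda>y::('a \<Rightarrow> real) + ('a \<Rightarrow> real) \<Rightarrow> real. \<lambda>f\<in>M. y (Inl f))"
  define h where "h = (\<lambda>p. \<lambda>i\<in>I. case i of Inl f \<Rightarrow> p f :: real | Inr f \<Rightarrow> inverse (p f))"
  define C where "C = {y \<in> topspace (powertop_real I). \<pi> y \<in> topspace (stone_cech X)}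
      \<inter> (\<Inter>f\<in>N. {y \<in> topspace (powertop_real I). y (Inl f) * y (Inr f) \<in> {1}})"
  let ?U = "subtopology (stone_cech X) (positive_points X)"
  have U: "p \<in> positive_points X \<longleftrightarrow> p \<in> topspace (stone_cech X) \<and> (\<forall>f\<in>N. 0 < p f)" for p
    by (auto simp: positive_points_def N_def M_def)
  have proj: "continuous_map (powertop_real I) euclideanreal (\<lambda>y. y i)" if "i \<in> I" for i
    using that by (intro continuous_map_product_projection)
  have \<pi>: "continuous_map (powertop_real I) (powertop_real M) \<pi>"
    unfolding continuous_map_componentwise
  proof (intro conjI ballI)
    show "\<pi> ` topspace (powertop_real I) \<subseteq> extensional M" by (auto simp: \<pi>_def)
    fix f assume "f \<in> M"
    then show "continuous_map (powertop_real I) euclideanreal (\<lambda>y. \<pi> y f)"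
      using proj[of "Inl f"] by (simp add: \<pi>_def I_def InlI)
  qed
  have NI: "Inl f \<in> I" "Inr f \<in> I" if "f \<in> N" for f
    using that by (auto simp: I_def N_def)
  have "closedin (powertop_real I)
      {y \<in> topspace (powertop_real I). y (Inl f) * y (Inr f) \<in> {1}}" if "f \<in> N" for f
    by (intro closedin_continuous_map_preimage[where Y = euclideanreal] continuous_intros proj
        NI that) simp
  moreover have "closedin (powertop_real I)
      {y \<in> topspace (powertop_real I). \<pi> y \<in> topspace (stone_cech X)}"
    using \<pi> closedin_topspace_stone_cech[of X] unfolding M_def
    by (rule closedin_continuous_map_preimage)
  \<comment> \<open>For empty \<open>N\<close> the inner intersection is the whole type rather than
    a closed set, hence the case split.\<close>
  ultimately have C: "closedin (powertop_real I) C"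
    unfolding C_def by (cases "N = {}") (auto intro!: closedin_Int closedin_INT)
  have CI: "C \<subseteq> topspace (powertop_real I)"
    using C closedin_subset by blast
  have pM: "p \<in> extensional M" if "p \<in> topspace (stone_cech X)" for p
    using that closedin_subset[OF closedin_topspace_stone_cech[of X]]
    by (auto simp: M_def PiE_def)
  have \<pi>h: "\<pi> (h p) = p" if "p \<in> positive_points X" for p
    using that pM[of p] by (auto simp: U \<pi>_def h_def I_def fun_eq_iff extensional_def)
  have hC: "h p \<in> C" if "p \<in> positive_points X" for p
  proof -
    have "h p (Inl f) * h p (Inr f) = 1" if "f \<in> N" for f
      using NI[OF that] that \<open>p \<in> positive_points X\<close> by (auto simp: h_def U)
    then show ?thesis
      using that \<pi>h[OF that] by (auto simp: C_def U h_def)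
  qed
  have cont_h: "continuous_map ?U (powertop_real I) h"
    unfolding continuous_map_componentwise
  proof (intro conjI ballI)
    show "h ` topspace ?U \<subseteq> extensional I" by (auto simp: h_def)
    fix i assume i: "i \<in> I"
    show "continuous_map ?U euclideanreal (\<lambda>p. h p i)"
    proof (cases i)
      case (Inl f)
      with i have "f \<in> unit_maps X" by (auto simp: I_def M_def)
      then show ?thesis
        using i Inl
        by (simp add: h_def continuous_map_from_subtopology continuous_map_stone_cech_eval)
    next
      case (Inr f)
      with i have f: "f \<in> N" "f \<in> unit_maps X" by (auto simp: I_def M_def N_def)
      have "continuous_map ?U euclideanreal (\<lambda>p. inverse (p f))"
        using f by (intro continuous_intros continuous_map_from_subtopology
            continuous_map_stone_cech_eval) (force simp: U)+
      then show ?thesis using i Inr by (simp add: h_def)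
    qed
  qed
  have \<pi>U: "\<pi> y \<in> positive_points X" and h\<pi>: "h (\<pi> y) = y" if y: "y \<in> C" for y
  proof -
    have eq1: "y (Inl f) * y (Inr f) = 1" if "f \<in> N" for f
      using y that by (auto simp: C_def)
    have top: "\<pi> y \<in> topspace (stone_cech X)" using y by (simp add: C_def)
    \<comment> \<open>Membership in the cube gives nonnegativity, and \<open>eq1\<close> excludes
      zero.\<close>
    have "0 < \<pi> y f" if f: "f \<in> N" for f
    proof -
      have "f \<in> M" using f by (simp add: N_def)
      have "\<pi> y \<in> topspace (unit_cube X)"
        using top unfolding stone_cech_def by simp
      then have "0 \<le> \<pi> y f"
        using \<open>f \<in> M\<close> by (auto simp: unit_cube_def M_def)
      moreover have "\<pi> y f \<noteq> 0"
        using eq1[OF f] \<open>f \<in> M\<close> by (auto simp: \<pi>_def)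
      ultimately show ?thesis by simp
    qed
    then show "\<pi> y \<in> positive_points X" using top by (simp add: U)
    have "y \<in> extensional I" using y CI by (auto simp: PiE_def)
    moreover have "h (\<pi> y) i = y i" if "i \<in> I" for i
      using that
    proof (cases i)
      case (Inr f)
      with that have "f \<in> N" by (auto simp: I_def)
      then show ?thesis
        using that Inr eq1[of f] by (auto simp: h_def \<pi>_def N_def intro: inverse_unique)
    qed (auto simp: h_def \<pi>_def I_def)
    ultimately show "h (\<pi> y) = y"
      by (intro extensionalityI[of _ I]) (auto simp: h_def)
  qed
  have "continuous_map (subtopology (powertop_real I) C) (stone_cech X) \<pi>"
    by (subst stone_cech_eq, intro continuous_map_into_subtopology continuous_map_from_subtopology)
      (use \<pi> in \<open>auto simp: M_def C_def\<close>)
  then have "continuous_map (subtopology (powertop_real I) C) ?U \<pi>"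
    using \<pi>U by (auto intro!: continuous_map_into_subtopology)
  moreover have "continuous_map ?U (subtopology (powertop_real I) C) h"
    using cont_h hC by (intro continuous_map_into_subtopology) auto
  ultimately have "homeomorphic_maps ?U (subtopology (powertop_real I) C) h \<pi>"
    using \<pi>h h\<pi> unfolding homeomorphic_maps_def by auto
  then have "?U homeomorphic_space subtopology (powertop_real I) C"
    unfolding homeomorphic_space_def by blast
  \<comment> \<open>The exponent \<open>I\<close> has a sum type; \<open>realcompact_spaceI\<close>
    moves it to the type fixed in the definition.\<close>
  with C show ?thesis by (rule realcompact_spaceI)
qed

lemma is_hewitt_positive_points: "is_hewitt_realcompactification X (positive_points X)"
  unfolding is_hewitt_realcompactification_def
  by (intro conjI allI impI closure_of_subspace_stone_cech realcompact_space_positive_points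
      positive_points_subset positive_points_extension)
    (auto simp: stone_cech_map_in_positive_points)

text \<open>For positive \<open>f\<close> the function \<open>1/f\<close> extends over
  \<open>V\<close>. Its extension times the coordinate at \<open>f\<close> equals 1 on the dense
  image of X, hence on all of \<open>V\<close>, so that coordinate cannot vanish.\<close>

lemma hewitt_subset_positive_points:
  assumes "is_hewitt_realcompactification X V"
  shows "V \<subseteq> positive_points X"
proof
  fix p assume p: "p \<in> V"
  let ?V = "subtopology (stone_cech X) V"
  have eV: "stone_cech_map X ` topspace X \<subseteq> V" and V: "V \<subseteq> topspace (stone_cech X)"
    and dense: "?V closure_of (stone_cech_map X ` topspace X) = V"
    and ext: "\<And>f. continuous_map X euclideanreal f \<Longrightarrow>
          \<exists>g. continuous_map ?V euclideanreal g \<and> (\<forall>x\<in>topspace X. g (stone_cech_map X x) = f x)"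
    using assms unfolding is_hewitt_realcompactification_def by auto
  have "0 < p f" if f: "f \<in> unit_maps X" and pos: "\<forall>x\<in>topspace X. 0 < f x" for f
  proof -
    have "continuous_map X euclideanreal f"
      using f by (auto simp: unit_maps_def continuous_map_in_subtopology)
    then have "continuous_map X euclideanreal (\<lambda>x. inverse (f x))"
      using pos by (intro continuous_intros) force+
    then obtain g where g: "continuous_map ?V euclideanreal g"
      and gf: "\<And>x. x \<in> topspace X \<Longrightarrow> g (stone_cech_map X x) = inverse (f x)"
      using ext by blast
    have "g p * p f = 1"
    proof (rule forall_in_closure_of_eq[where X = ?V and Y = euclideanreal
          and f = "\<lambda>p. g p * p f" and g = "\<lambda>_. 1"])
      show "p \<in> ?V closure_of (stone_cech_map X ` topspace X)" using p dense by simp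
      show "continuous_map ?V euclideanreal (\<lambda>p. g p * p f)"
        by (intro continuous_intros g continuous_map_from_subtopology
            continuous_map_stone_cech_eval f)
      show "g q * q f = 1" if q: "q \<in> stone_cech_map X ` topspace X" for q
        using q pos gf by (force simp: stone_cech_map_apply f)
    qed simp_all
    then have "p f \<noteq> 0" by auto
    moreover have "p \<in> topspace (unit_cube X)"
      using p V unfolding stone_cech_def by auto
    then have "0 \<le> p f"
      using f by (auto simp: unit_cube_def)
    ultimately show ?thesis by simp
  qed
  then show "p \<in> positive_points X"
    using p V by (auto simp: positive_points_def)
qed

text \<open>
  Extending all coordinates of a closed embedding of \<open>V\<close> in a power of the line gives a retraction
  of the positive points to \<open>V\<close> that fixes the dense image of \<open>X\<close>, hence is the identity.
\<close>

lemma positive_points_subset_hewitt: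
  assumes "is_hewitt_realcompactification X V"
  shows "positive_points X \<subseteq> V"
proof
  fix p assume p: "p \<in> positive_points X"
  let ?V = "subtopology (stone_cech X) V"
  let ?U = "subtopology (stone_cech X) (positive_points X)"
  let ?E = "stone_cech_map X ` topspace X"
  have eV: "?E \<subseteq> V" and V: "V \<subseteq> topspace (stone_cech X)" and rc: "realcompact_space ?V"
    using assms unfolding is_hewitt_realcompactification_def by auto
  have topV: "topspace ?V = V" using V by auto
  obtain I :: "((('a \<Rightarrow> real) \<Rightarrow> real) \<Rightarrow> real) set" and C
    where C: "closedin (powertop_real I) C"
      and "?V homeomorphic_space subtopology (powertop_real I) C"
    using rc unfolding realcompact_space_def by blast
  then obtain h k where "homeomorphic_maps ?V (subtopology (powertop_real I) C) h k"
    unfolding homeomorphic_space_def by blast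
  then have h: "continuous_map ?V (subtopology (powertop_real I) C) h"
    and k: "continuous_map (subtopology (powertop_real I) C) ?V k"
    and kh: "\<And>x. x \<in> V \<Longrightarrow> k (h x) = x"
    unfolding homeomorphic_maps_def topV by auto
  have hI: "continuous_map ?V (powertop_real I) h" and hC: "h \<in> V \<rightarrow> C"
    using h by (auto simp: continuous_map_in_subtopology Int_absorb1[OF V])
  have eX: "continuous_map X ?V (stone_cech_map X)"
    using continuous_map_stone_cech_map eV by (auto intro!: continuous_map_into_subtopology)
  have "\<exists>g. continuous_map ?U euclideanreal g
          \<and> (\<forall>x\<in>topspace X. g (stone_cech_map X x) = h (stone_cech_map X x) i)" if "i \<in> I" for i
  proof (rule positive_points_extension)
    have "continuous_map ?V euclideanreal (\<lambda>q. h q i)"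
      using hI that by (simp add: continuous_map_componentwise)
    then show "continuous_map X euclideanreal (\<lambda>x. h (stone_cech_map X x) i)"
      using continuous_map_compose[OF eX] by (simp add: o_def)
  qed
  then obtain G where G: "\<And>i. i \<in> I \<Longrightarrow> continuous_map ?U euclideanreal (G i)"
    and Gh: "\<And>i x. i \<in> I \<Longrightarrow> x \<in> topspace X \<Longrightarrow>
                 G i (stone_cech_map X x) = h (stone_cech_map X x) i"
    by metis
  define H where "H = (\<lambda>q. \<lambda>i\<in>I. G i q)"
  have H: "continuous_map ?U (powertop_real I) H"
    unfolding continuous_map_componentwise using G by (auto simp: H_def)
  have Hh: "H q = h q" if "q \<in> ?E" for q
  proof -
    have "h q \<in> extensional I"
      using hC eV that closedin_subset[OF C] by (auto simp: PiE_def)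
    then show ?thesis
      using that Gh by (auto simp: H_def fun_eq_iff extensional_def)
  qed
  have dense: "?U closure_of ?E = positive_points X"
    by (intro closure_of_subspace_stone_cech positive_points_subset)
      (auto simp: stone_cech_map_in_positive_points)
  \<comment> \<open>Realcompactness of \<open>V\<close> enters here: \<open>C\<close> is closed and
    contains the values of \<open>H\<close> on a dense set, so it contains all of them.\<close>
  have HC: "H q \<in> C" if "q \<in> positive_points X" for q
  proof (rule forall_in_closure_of[where X = ?U and S = ?E and P = "\<lambda>q. H q \<in> C"])
    show "q \<in> ?U closure_of ?E" using that dense by simp
    show "H r \<in> C" if "r \<in> ?E" for r using Hh[OF that] that hC eV by auto
    show "closedin ?U {x \<in> topspace ?U. H x \<in> C}"
      using H C by (rule closedin_continuous_map_preimage)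
  qed
  have kH: "continuous_map ?U ?V (k \<circ> H)"
    using H HC by (intro continuous_map_compose[OF _ k] continuous_map_into_subtopology) auto
  \<comment> \<open>The two maps are compared in the Hausdorff space \<open>stone_cech X\<close>,
    since \<open>p\<close> is not yet known to lie in \<open>V\<close>.\<close>
  have "(k \<circ> H) p = id p"
  proof (rule forall_in_closure_of_eq[where X = ?U and Y = "stone_cech X" and S = ?E
        and f = "k \<circ> H" and g = id])
    show "continuous_map ?U (stone_cech X) (k \<circ> H)"
      using kH by (rule continuous_map_into_fulltopology)
    show "(k \<circ> H) q = id q" if "q \<in> ?E" for q
      using that eV kh Hh by auto
  qed (use p dense in \<open>auto simp: Hausdorff_space_stone_cech\<close>)
  moreover have "(k \<circ> H) p \<in> V"
    using continuous_map_funspace[OF kH] p unfolding topV topspace_positive_points by blast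
  ultimately show "p \<in> V" by simp
qed

lemma hewitt_eq_positive_points: "hewitt X = positive_points X"
  unfolding hewitt_def
proof (rule the_equality)
  show "is_hewitt_realcompactification X (positive_points X)"
    by (rule is_hewitt_positive_points)
  show "V = positive_points X" if "is_hewitt_realcompactification X V" for V
    using hewitt_subset_positive_points[OF that] positive_points_subset_hewitt[OF that] by blast
qed

section \<open>Countable compactness and bounded functions\<close>

text \<open>The open sets \<open>W n\<close> cover the space because \<open>f\<close> is positive,
  and they increase with \<open>n\<close>; the largest index in a finite subcover yields the
  bound.\<close>

lemma countably_compact_space_bounded_below:
  assumes "countably_compact_space X" and "continuous_map X euclideanreal f"
    and "\<And>x. x \<in> topspace X \<Longrightarrow> 0 < f x"
  obtains e where "0 < e" and "\<And>x. x \<in> topspace X \<Longrightarrow> e \<le> f x"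
proof -
  define W where "W = (\<lambda>n. {x \<in> topspace X. f x \<in> {inverse (real (Suc n))<..}})"
  have "openin X (W n)" for n
    unfolding W_def using assms(2)
    by (rule openin_continuous_map_preimage) simp
  moreover have "topspace X \<subseteq> \<Union> (range W)"
    using assms(3) reals_Archimedean by (fastforce simp: W_def)
  ultimately have "countable (range W) \<and> (\<forall>U\<in>range W. openin X U) \<and> topspace X \<subseteq> \<Union> (range W)"
    by auto
  then obtain \<F> where "finite \<F>" "\<F> \<subseteq> range W" and cover: "topspace X \<subseteq> \<Union>\<F>"
    using assms(1)[unfolded countably_compact_space_def, THEN spec, THEN mp] by metis
  then obtain K where K: "finite K" "\<F> = W ` K"
    by (metis finite_subset_image)
  show ?thesis
  proof
    \<comment> \<open>The inserted 0 keeps the maximum meaningful when \<open>K\<close> is empty,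
      which can happen for an empty space.\<close>
    let ?m = "Max (insert 0 K)"
    show "0 < inverse (real (Suc ?m))" by simp
    fix x assume "x \<in> topspace X"
    then obtain n where n: "n \<in> K" "x \<in> W n" using cover K by auto
    have "n \<le> ?m" using K n by (intro Max_ge) auto
    then have "inverse (real (Suc ?m)) \<le> inverse (real (Suc n))"
      by (intro le_imp_inverse_le) auto
    also have "\<dots> \<le> f x" using n by (simp add: W_def)
    finally show "inverse (real (Suc ?m)) \<le> f x" .
  qed
qed

lemma countably_compact_space_closed_bounded:
  assumes X: "normal_space X" "Hausdorff_space X" and D: "closedin X D"
    and bounded: "\<And>f. continuous_map X euclideanreal f \<Longrightarrow> bdd_above (f ` D)"
  shows "countably_compact_space (subtopology X D)"
  unfolding countably_compact_space_def
proof (intro allI impI, elim conjE)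
  fix \<U>
  assume "countable \<U>" and op: "\<forall>U\<in>\<U>. openin (subtopology X D) U"
    and "topspace (subtopology X D) \<subseteq> \<Union>\<U>"
  have topD: "topspace (subtopology X D) = D"
    using closedin_subset[OF D] by auto
  then have cover: "D \<subseteq> \<Union>\<U>" using \<open>topspace _ \<subseteq> \<Union>\<U>\<close> by simp
  show "\<exists>\<F>. finite \<F> \<and> \<F> \<subseteq> \<U> \<and> topspace (subtopology X D) \<subseteq> \<Union>\<F>"
  proof (rule ccontr)
    assume no: "\<nexists>\<F>. finite \<F> \<and> \<F> \<subseteq> \<U> \<and> topspace (subtopology X D) \<subseteq> \<Union>\<F>"
    then have "\<U> \<noteq> {}" using cover topD by fastforce
    define U where "U = from_nat_into \<U>"
    have rU: "range U = \<U>"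
      unfolding U_def using \<open>\<U> \<noteq> {}\<close> \<open>countable \<U>\<close> by (rule range_from_nat_into)
    \<comment> \<open>The first \<open>n + 1\<close> members of the cover do not exhaust
      \<open>D\<close>. The chosen points may repeat, so the argument works with the set
      \<open>range x\<close> instead of the sequence.\<close>
    have "\<exists>x. x \<in> D \<and> (\<forall>k\<le>n. x \<notin> U k)" for n
    proof -
      have "\<not> D \<subseteq> \<Union> (U ` {..n})"
        using no[unfolded topD] rU by (metis finite_atMost finite_imageI image_mono subset_UNIV)
      then show ?thesis by auto
    qed
    then obtain x where xD: "\<And>n. x n \<in> D" and xU: "\<And>n k. k \<le> n \<Longrightarrow> x n \<notin> U k"
      by metis
    \<comment> \<open>The singletons of \<open>T\<close> form a locally finite family of closed
      sets: the complement of \<open>D\<close> meets none of them, and an open set with trace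
      \<open>U k\<close> on \<open>D\<close> contains \<open>x n\<close> only for
      \<open>n < k\<close>.\<close>
    have T: "closedin X T" if T: "T \<subseteq> range x" for T
    proof -
      have TD: "T \<subseteq> D" using T xD by auto
      have "locally_finite_in X ((\<lambda>t. {t}) ` T)"
        unfolding locally_finite_in_def
      proof (intro conjI ballI)
        show "\<Union> ((\<lambda>t. {t}) ` T) \<subseteq> topspace X"
          using TD closedin_subset[OF D] by auto
        fix y assume y: "y \<in> topspace X"
        show "\<exists>V. openin X V \<and> y \<in> V \<and> finite {S \<in> (\<lambda>t. {t}) ` T. S \<inter> V \<noteq> {}}"
        proof (cases "y \<in> D")
          case False
          have "{S \<in> (\<lambda>t. {t}) ` T. S \<inter> (topspace X - D) \<noteq> {}} = {}"
            using TD by auto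
          then have "finite {S \<in> (\<lambda>t. {t}) ` T. S \<inter> (topspace X - D) \<noteq> {}}"
            by (metis finite.emptyI)
          then show ?thesis
            using D y False by (intro exI[of _ "topspace X - D"]) (simp add: closedin_def)
        next
          case True
          then obtain k where k: "y \<in> U k" using cover rU by blast
          then obtain V where V: "openin X V" "U k = V \<inter> D"
            using op rU unfolding openin_subtopology by blast
          have "t \<in> x ` {..<k}" if t: "t \<in> T" "t \<in> V" for t
          proof -
            obtain n where n: "t = x n" using t T by auto
            then have "t \<in> U k" using t V xD by auto
            then have "n < k" using n xU[of k n] by (meson not_le)
            then show ?thesis using n by auto
          qed
          then have "{S \<in> (\<lambda>t. {t}) ` T. S \<inter> V \<noteq> {}} \<subseteq> (\<lambda>t. {t}) ` x ` {..<k}"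
            by auto
          then have "finite {S \<in> (\<lambda>t. {t}) ` T. S \<inter> V \<noteq> {}}"
            by (rule finite_subset) simp
          then show ?thesis using V k by blast
        qed
      qed
      moreover have "closedin X S" if "S \<in> (\<lambda>t. {t}) ` T" for S
        using that TD closedin_subset[OF D] X(2) by (auto simp: closedin_Hausdorff_sing_eq)
      ultimately show ?thesis
        using closedin_locally_finite_Union[of "(\<lambda>t. {t}) ` T" X] by simp
    qed
    \<comment> \<open>Defined from the point, not from its index, so repetitions do no harm. By
      \<open>xU\<close> its value at \<open>x n\<close> exceeds \<open>n\<close>.\<close>
    define g where "g = (\<lambda>y. real (LEAST k. y \<in> U k))"
    \<comment> \<open>Every subset of \<open>range x\<close> is closed, so this subspace is discrete
      and any function on it is continuous.\<close>
    have "continuous_map (subtopology X (range x)) euclideanreal g"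
      unfolding continuous_map_closedin
      by (auto intro!: closedin_subset_topspace T)
    then obtain f where f: "continuous_map X euclideanreal f"
      and fg: "\<And>y. y \<in> range x \<Longrightarrow> f y = g y"
      using Tietze_extension_realinterval[OF X(1) T[of "range x"], of UNIV g]
      by (metis empty_not_UNIV is_interval_univ subset_UNIV subset_refl)
    obtain B where B: "\<And>y. y \<in> D \<Longrightarrow> f y \<le> B"
      using bounded[OF f] unfolding bdd_above_def by auto
    obtain n where n: "B < real n" using reals_Archimedean2 by blast
    obtain k where "x n \<in> U k" using xD[of n] cover rU by blast
    then have "x n \<in> U (LEAST k. x n \<in> U k)" by (rule LeastI)
    then have "n < (LEAST k. x n \<in> U k)" using xU by (meson not_le)
    then have "real n < f (x n)" using fg[of "x n"] by (simp add: g_def)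
    then show False using B[OF xD[of n]] n by linarith
  qed
qed

section \<open>The extension determined by countable compactness\<close>

text \<open>A lower bound \<open>e > 0\<close> for \<open>f\<close> on the closure of
  \<open>C\<close> passes to the closure in \<beta>X, because the condition
  \<open>e \<le> q f\<close> is closed in \<open>q\<close>.\<close>

lemma closure_of_countably_compact_subset_positive_points:
  assumes C: "C \<subseteq> topspace X" and cc: "countably_compact_space (subtopology X (X closure_of C))"
  shows "stone_cech X closure_of (stone_cech_map X ` C) \<subseteq> positive_points X"
proof
  fix p assume p: "p \<in> stone_cech X closure_of (stone_cech_map X ` C)"
  have "0 < p f" if f: "f \<in> unit_maps X" and pos: "\<forall>x\<in>topspace X. 0 < f x" for f
  proof -
    have "continuous_map X euclideanreal f"
      using f by (auto simp: unit_maps_def continuous_map_in_subtopology)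
    then have "continuous_map (subtopology X (X closure_of C)) euclideanreal f"
      by (rule continuous_map_from_subtopology)
    then obtain e where e: "0 < e"
      "\<And>x. x \<in> topspace (subtopology X (X closure_of C)) \<Longrightarrow> e \<le> f x"
      by (rule countably_compact_space_bounded_below[OF cc]) (use pos in auto)
    have eC: "e \<le> f x" if "x \<in> C" for x
      using e(2)[of x] that closure_of_subset[OF C] C by auto
    have "p f \<in> {e..}"
    proof (rule forall_in_closure_of[OF p])
      show "q f \<in> {e..}" if "q \<in> stone_cech_map X ` C" for q
        using that eC by (auto simp: stone_cech_map_apply f)
      show "closedin (stone_cech X) {q \<in> topspace (stone_cech X). q f \<in> {e..}}"
        using continuous_map_stone_cech_eval[OF f]
        by (rule closedin_continuous_map_preimage) simp
    qed
    then show ?thesis using e(1) by simp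
  qed
  moreover have "p \<in> topspace (stone_cech X)"
    using p closure_of_subset_topspace by fastforce
  ultimately show "p \<in> positive_points X" by (simp add: positive_points_def)
qed

text \<open>The extension of \<open>f\<close> to the positive points maps the compact set
  \<open>K\<close> to a compact, hence bounded, set of reals.\<close>

lemma bdd_above_trace_compact:
  assumes K: "compactin (stone_cech X) K" "K \<subseteq> positive_points X"
    and f: "continuous_map X euclideanreal f"
  shows "bdd_above (f ` {x \<in> topspace X. stone_cech_map X x \<in> K})"
proof -
  obtain g where g: "continuous_map (subtopology (stone_cech X) (positive_points X)) euclideanreal g"
    and gf: "\<And>x. x \<in> topspace X \<Longrightarrow> g (stone_cech_map X x) = f x"
    using positive_points_extension[OF f] by blast
  have "compactin euclideanreal (g ` K)"
    using K g by (intro image_compactin[OF _ g]) (simp add: compactin_subtopology)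
  then have "bdd_above (g ` K)"
    by (simp add: compact_imp_bounded bounded_imp_bdd_above)
  moreover have "f ` {x \<in> topspace X. stone_cech_map X x \<in> K} \<subseteq> g ` K"
    using gf by force
  ultimately show ?thesis by (rule bdd_above_mono)
qed

text \<open>The embedding \<open>of_real\<close> preserves zeros and absolute values, so real
  functions provide cozero sets for every scalar field.\<close>

lemma cozero_setsI:
  assumes f: "continuous_map X euclideanreal f" and b: "\<And>x. x \<in> topspace X \<Longrightarrow> \<bar>f x\<bar> \<le> b"
  shows "{x \<in> topspace X. f x \<noteq> 0} \<in> cozero_sets TYPE('k::real_normed_field) X"
proof -
  let ?g = "\<lambda>x. of_real (f x) :: 'k"
  have "continuous_map euclideanreal euclidean (of_real :: real \<Rightarrow> 'k)"
    by (simp add: continuous_on_of_real)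
  with f have "continuous_map X euclidean ((of_real :: real \<Rightarrow> 'k) \<circ> f)"
    by (rule continuous_map_compose)
  then have "continuous_map X euclidean ?g"
    by (simp add: o_def)
  moreover have "bounded (?g ` topspace X)"
    using b by (auto simp: bounded_iff)
  moreover have "{x \<in> topspace X. f x \<noteq> 0} = cozero_set X ?g"
    by (simp add: cozero_set_def)
  ultimately show ?thesis unfolding cozero_sets_def by blast
qed

lemma lambda_ext_subset:
  "lambda_ext K countably_compact_space X \<subseteq> stone_cech X interior_of positive_points X"
proof -
  have "stone_cech X interior_of (stone_cech X closure_of (stone_cech_map X ` C))
          \<subseteq> stone_cech X interior_of positive_points X"
    if "C \<in> cozero_sets K X" "countably_compact_space (subtopology X (X closure_of C))" for C
  proof (rule interior_of_mono, rule closure_of_countably_compact_subset_positive_points)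
    show "C \<subseteq> topspace X" using that by (auto simp: cozero_sets_def cozero_set_def)
  qed (use that in simp)
  then show ?thesis unfolding lambda_ext_def by blast
qed

lemma interior_of_subset_lambda_ext:
  fixes K :: "'k::real_normed_field itself"
  assumes X: "normal_space X" "Hausdorff_space X"
  shows "stone_cech X interior_of positive_points X \<subseteq> lambda_ext K countably_compact_space X"
proof
  let ?B = "stone_cech X" and ?e = "stone_cech_map X"
  fix p assume p: "p \<in> ?B interior_of positive_points X"
  \<comment> \<open>Complete regularity of the compact Hausdorff space \<beta>X separates
    \<open>p\<close> from the complement of the interior.\<close>
  have "completely_regular_space ?B"
    by (intro normal_imp_completely_regular_space compact_Hausdorff_or_regular_imp_normal_space
        compact_space_stone_cech disjI1 Hausdorff_space_stone_cech)
  moreover have "closedin ?B (topspace ?B - ?B interior_of positive_points X)"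
    by auto
  ultimately obtain F :: "(('a \<Rightarrow> real) \<Rightarrow> real) \<Rightarrow> real"
    where F: "continuous_map ?B (top_of_set {0..1}) F" and Fp: "F p = 0"
      and F1: "F ` (topspace ?B - ?B interior_of positive_points X) \<subseteq> {1}"
    using p interior_of_subset_topspace[of ?B "positive_points X"]
    unfolding completely_regular_space_def by (metis (no_types, lifting) Diff_Diff_Int Int_absorb1)
  have Fc: "continuous_map ?B euclideanreal F" and F01: "\<And>q. q \<in> topspace ?B \<Longrightarrow> F q \<in> {0..1}"
    using F by (auto simp: continuous_map_in_subtopology)
  \<comment> \<open>Two sets at one level: \<open>W\<close> is an open neighbourhood of
    \<open>p\<close>, while the larger closed set \<open>A\<close> is compact and still avoids the
    region where \<open>F\<close> is 1.\<close>
  define A where "A = {q \<in> topspace ?B. F q \<in> {..1/2}}"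
  define W where "W = {q \<in> topspace ?B. F q \<in> {..<1/2}}"
  have A: "closedin ?B A"
    unfolding A_def using Fc by (rule closedin_continuous_map_preimage) simp
  have W: "openin ?B W"
    unfolding W_def using Fc by (rule openin_continuous_map_preimage) simp
  have pW: "p \<in> W"
    using p Fp interior_of_subset_topspace[of ?B "positive_points X"] by (auto simp: W_def)
  have "A \<subseteq> ?B interior_of positive_points X"
    using F1 by (force simp: A_def)
  then have AU: "A \<subseteq> positive_points X"
    by (rule subset_trans[OF _ interior_of_subset])
  define D where "D = {x \<in> topspace X. ?e x \<in> A}"
  define C where "C = {x \<in> topspace X. ?e x \<in> W}"
  have D: "closedin X D"
    unfolding D_def using continuous_map_stone_cech_map A by (rule closedin_continuous_map_preimage)
  have clC: "X closure_of C \<subseteq> D"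
    by (rule closure_of_minimal[OF _ D]) (auto simp: C_def D_def A_def W_def)
  \<comment> \<open>Compactness of \<open>A\<close> bounds every real function on its trace
    \<open>D\<close>, hence on the closed subset \<open>X closure_of C\<close>.\<close>
  have "countably_compact_space (subtopology X (X closure_of C))"
  proof (rule countably_compact_space_closed_bounded[OF X closedin_closure_of])
    fix f assume f: "continuous_map X euclideanreal f"
    have "bdd_above (f ` D)"
      unfolding D_def
      using closedin_compact_space[OF compact_space_stone_cech A] AU f
      by (rule bdd_above_trace_compact)
    then show "bdd_above (f ` (X closure_of C))"
      using clC by (meson bdd_above_mono image_mono)
  qed
  moreover have "C \<in> cozero_sets K X"
  proof -
    \<comment> \<open>The truncation is nonzero exactly where \<open>F < 1/2\<close>, which makes
      \<open>C\<close> its cozero set.\<close>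
    let ?c = "\<lambda>x. max 0 (1/2 - F (?e x))"
    have "continuous_map X euclideanreal (\<lambda>x. F (?e x))"
      using continuous_map_compose[OF continuous_map_stone_cech_map Fc] by (simp add: o_def)
    then have "continuous_map X euclideanreal ?c"
      by (intro continuous_intros) auto
    moreover have "\<bar>?c x\<bar> \<le> 1" if "x \<in> topspace X" for x
      using F01[OF stone_cech_map_in_topspace[OF that]] by auto
    ultimately have "{x \<in> topspace X. ?c x \<noteq> 0} \<in> cozero_sets TYPE('k) X"
      by (rule cozero_setsI)
    moreover have "C = {x \<in> topspace X. ?c x \<noteq> 0}"
      using stone_cech_map_in_topspace by (auto simp: C_def W_def max_def)
    ultimately show ?thesis by (simp add: cozero_sets_def)
  qed
  \<comment> \<open>A dense set meets an open set in a dense subset of it, and the trace of X on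
    \<open>W\<close> is the image of \<open>C\<close>.\<close>
  moreover have "W \<subseteq> ?B closure_of (?e ` C)"
  proof -
    have "W \<subseteq> W \<inter> ?B closure_of (?e ` topspace X)"
      using openin_subset[OF W] by (simp add: stone_cech_dense)
    also have "\<dots> \<subseteq> ?B closure_of (W \<inter> ?e ` topspace X)"
      using W by (rule openin_Int_closure_of_subset)
    also have "W \<inter> ?e ` topspace X = ?e ` C" by (auto simp: C_def)
    finally show ?thesis .
  qed
  then have "W \<subseteq> ?B interior_of (?B closure_of (?e ` C))"
    using W by (rule interior_of_maximal)
  then have "p \<in> ?B interior_of (?B closure_of (?e ` C))"
    using pW by (rule subsetD)
  ultimately show "p \<in> lambda_ext K countably_compact_space X"
    unfolding lambda_ext_def by blast
qed

theorem theorem5p3: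
  fixes X :: "'a topology"
  assumes "topspace X \<noteq> {}" and "Hausdorff_space X" and "normal_space X"
  shows "lambda_ext TYPE(real) countably_compact_space X = stone_cech X interior_of hewitt X
    \<and> lambda_ext TYPE(complex) countably_compact_space X = stone_cech X interior_of hewitt X"
  unfolding hewitt_eq_positive_points
  using assms(2,3) by (intro conjI subset_antisym lambda_ext_subset interior_of_subset_lambda_ext)

end
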